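(* Let $A$ and $B$ be left braces of a finite multipermutation level. Then every semidirect product $A\rtimes B$ (with respect to any group homomorphism $\sigma:B^\circ\to\mathrm{Aut}(A)$) and the wreath product $A\wr B$ of the braces $A$ and $B$ are left braces of a finite multipermutation level.
   Context: A left brace is an abelian group $(A,+)$ with a multiplication $\cdot$ such that $a\cdot(b+c)=a\cdot b+a\cdot c$ for all $a,b,c\in A$ and such that the circle operation $a\circ b=a\cdot b+a+b$ makes $A$ into a group, the adjoint group $A^\circ$ (its identity $1$ equals $0$). Equivalently it is given by $(A,+,\circ)$, with $a\cdot b=a\circ b-a-b$. Put $A^{(1)}=A$ and let $A^{(n)}=A^{(n-1)}\cdot A$ be the additive subgroup generated by all $x\cdot a$ with $x\in A^{(n-1)}$, $a\in A$; $A$ has a finite multipermutation level if $A^{(n)}=0$ for some $n$. Homomorphisms of left braces are maps preserving $+$ and $\circ$; $\mathrm{Aut}(N)$ is the group of automorphisms of the left brace $N$. Semidirect product: for left braces $N,H$ and a group homomorphism $\sigma:H^\circ\to\mathrm{Aut}(N)$, the left brace $N\rtimes H$ is the set $N\times H$ with $(g_1,h_1)+(g_2,h_2)=(g_1+g_2,h_1+h_2)$ and $(g_1,h_1)\circ(g_2,h_2)=(g_1\circ\sigma(h_1)(g_2),h_1\circ h_2)$. Wreath product: for left braces $G,H$, let $W$ be the set of functions $f:H\to G$ with $f(h)\neq 0$ for only finitely many $h\in H$, a left brace under pointwise $+$ and $\circ$; then $G\wr H=W\rtimes H$ with respect to $\sigma:H^\circ\to\mathrm{Aut}(W)$, $\sigma(h)(f)(x)=f(h^{-1}\circ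 x)$, where $h^{-1}$ is the inverse in $H^\circ$. *)

theory Defs
  imports "HOL-Algebra.Ring" "HOL-Algebra.Bij" "HOL-Algebra.Generated_Groups"
begin

text \<open>
  A brace \<open>(A, +, \<circ>)\<close> is represented by the record \<open>'a ring\<close>, whose multiplicative part
  \<open>\<otimes>\<close>, \<open>\<one>\<close> holds the circle operation and its identity, and whose additive part \<open>\<oplus>\<close>, \<open>\<zero>\<close>
  holds the addition. So, for a brace \<open>A\<close>, the record \<open>A\<close> itself, seen as a monoid, is the
  adjoint group, while the brace product \<open>a \<cdot> b\<close> is the derived operation \<open>brace_mult A a b\<close>
  and not \<open>a \<otimes>\<^bsub>A\<^esub> b\<close>.
\<close>

definition brace_mult :: "('a, 'm) ring_scheme \<Rightarrow> 'a \<Rightarrow> 'a \<Rightarrow> 'a" where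
  "brace_mult A a b = a \<otimes>\<^bsub>A\<^esub> b \<ominus>\<^bsub>A\<^esub> a \<ominus>\<^bsub>A\<^esub> b"

locale left_brace = abelian_group A + group A for A (structure) +
  assumes brace_distrib:
    "\<lbrakk>a \<in> carrier A; b \<in> carrier A; c \<in> carrier A\<rbrakk> \<Longrightarrow>
      brace_mult A a (b \<oplus> c) = brace_mult A a b \<oplus> brace_mult A a c"

text \<open>The right series \<open>A\<^sup>(\<^sup>n\<^sup>)\<close> is indexed from 1; the value at 0 is a dummy.\<close>

fun brace_series :: "('a, 'm) ring_scheme \<Rightarrow> nat \<Rightarrow> 'a set" where
  "brace_series A 0 = carrier A"
| "brace_series A (Suc 0) = carrier A"
| "brace_series A (Suc (Suc n)) = generate (add_monoid A)
     {brace_mult A x a | x a. x \<in> brace_series A (Suc n) \<and> a \<in> carrier A}"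

definition finite_multipermutation_level :: "('a, 'm) ring_scheme \<Rightarrow> bool" where
  "finite_multipermutation_level A \<longleftrightarrow> (\<exists>n\<ge>1. brace_series A n = {\<zero>\<^bsub>A\<^esub>})"

definition brace_hom :: "('a, 'm) ring_scheme \<Rightarrow> ('b, 'n) ring_scheme \<Rightarrow> ('a \<Rightarrow> 'b) set" where
  "brace_hom A B = hom (add_monoid A) (add_monoid B) \<inter> hom A B"

text \<open>As for \<open>AutoGroup\<close>, automorphisms are taken to be extensional on the carrier.\<close>

definition brace_Aut :: "('a, 'm) ring_scheme \<Rightarrow> ('a \<Rightarrow> 'a) monoid" where
  "brace_Aut N = BijGroup (carrier N) \<lparr>carrier := brace_hom N N \<inter> Bij (carrier N)\<rparr>"

definition brace_semidirect ::
  "('a, 'm) ring_scheme \<Rightarrow> ('b, 'n) ring_scheme \<Rightarrow> ('b \<Rightarrow> 'a \<Rightarrow> 'a) \<Rightarrow> ('a \<times> 'b) ring" where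
  "brace_semidirect N H \<sigma> =
    \<lparr>carrier = carrier N \<times> carrier H,
     mult = (\<lambda>(g1, h1) (g2, h2). (g1 \<otimes>\<^bsub>N\<^esub> \<sigma> h1 g2, h1 \<otimes>\<^bsub>H\<^esub> h2)),
     one = (\<one>\<^bsub>N\<^esub>, \<one>\<^bsub>H\<^esub>),
     zero = (\<zero>\<^bsub>N\<^esub>, \<zero>\<^bsub>H\<^esub>),
     add = (\<lambda>(g1, h1) (g2, h2). (g1 \<oplus>\<^bsub>N\<^esub> g2, h1 \<oplus>\<^bsub>H\<^esub> h2))\<rparr>"

text \<open>
  Functions on the carrier of \<open>H\<close> are extensional, so that equality of functions means equality
  on the carrier.
\<close>

definition fin_supp_brace ::
  "('a, 'm) ring_scheme \<Rightarrow> ('b, 'n) ring_scheme \<Rightarrow> ('b \<Rightarrow> 'a) ring" where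
  "fin_supp_brace G H =
    \<lparr>carrier = {f \<in> carrier H \<rightarrow>\<^sub>E carrier G. finite {h \<in> carrier H. f h \<noteq> \<zero>\<^bsub>G\<^esub>}},
     mult = (\<lambda>f g. \<lambda>h\<in>carrier H. f h \<otimes>\<^bsub>G\<^esub> g h),
     one = (\<lambda>h\<in>carrier H. \<one>\<^bsub>G\<^esub>),
     zero = (\<lambda>h\<in>carrier H. \<zero>\<^bsub>G\<^esub>),
     add = (\<lambda>f g. \<lambda>h\<in>carrier H. f h \<oplus>\<^bsub>G\<^esub> g h)\<rparr>"

definition shift_action ::
  "('a, 'm) ring_scheme \<Rightarrow> ('b, 'n) ring_scheme \<Rightarrow> 'b \<Rightarrow> ('b \<Rightarrow> 'a) \<Rightarrow> ('b \<Rightarrow> 'a)" where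
  "shift_action G H h =
    (\<lambda>f\<in>carrier (fin_supp_brace G H). \<lambda>x\<in>carrier H. f (inv\<^bsub>H\<^esub> h \<otimes>\<^bsub>H\<^esub> x))"

definition brace_wreath ::
  "('a, 'm) ring_scheme \<Rightarrow> ('b, 'n) ring_scheme \<Rightarrow> (('b \<Rightarrow> 'a) \<times> 'b) ring" where
  "brace_wreath G H = brace_semidirect (fin_supp_brace G H) H (shift_action G H)"

end

theory Submission
  imports Defs
begin

text \<open>
  Homomorphisms of braces respect the right series. Applied to the projection of
  \<open>G = A \<rtimes> B\<close> onto \<open>B\<close>, this gives \<open>G\<^sup>(\<^sup>m\<^sup>) \<subseteq> A \<times> {0}\<close> as soon as \<open>B\<^sup>(\<^sup>m\<^sup>) = 0\<close>. Since
  \<open>\<sigma>(0)\<close> is the identity, \<open>(g, 0) \<cdot> (g', h') = (g \<cdot> g', 0)\<close>, so from there on the series of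
  \<open>G\<close> is bounded by that of \<open>A\<close>. The base of the wreath product is treated with the
  evaluation homomorphisms to \<open>A\<close>, which jointly separate its elements.
\<close>

subsection \<open>Left braces and their right series\<close>

text \<open>Trades the two subtractions in \<open>brace_mult\<close> for an equation in sums only.
  Nothing beyond closure is asked of \<open>\<otimes>\<close>, so it is available before a structure
  is known to be a brace.\<close>

lemma (in abelian_group) brace_mult_eq_iff:
  assumes "a \<in> carrier G" "b \<in> carrier G" "c \<in> carrier G" "a \<otimes> b \<in> carrier G"
  shows "brace_mult G a b = c \<longleftrightarrow> a \<otimes> b = c \<oplus> a \<oplus> b"
proof
  assume "brace_mult G a b = c"
  then have "c \<oplus> a \<oplus> b = (a \<otimes> b \<oplus> \<ominus> a \<oplus> \<ominus> b) \<oplus> a \<oplus> b"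
    by (simp add: brace_mult_def minus_eq)
  also have "\<dots> = a \<otimes> b \<oplus> (\<ominus> a \<oplus> a) \<oplus> (\<ominus> b \<oplus> b)"
    \<comment> \<open>With the cancellation rules removed, both sides are merely reordered to the
      same normal form; the pairs cancel in the next step.\<close>
    using assms by (simp add: a_ac del: l_neg r_neg)
  finally show "a \<otimes> b = c \<oplus> a \<oplus> b"
    using assms by (simp add: l_neg)
next
  assume "a \<otimes> b = c \<oplus> a \<oplus> b"
  then have "brace_mult G a b = (c \<oplus> a \<oplus> b) \<oplus> \<ominus> a \<oplus> \<ominus> b"
    by (simp add: brace_mult_def minus_eq)
  also have "\<dots> = c \<oplus> (a \<oplus> \<ominus> a) \<oplus> (b \<oplus> \<ominus> b)"
    using assms by (simp add: a_ac del: l_neg r_neg)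
  finally show "brace_mult G a b = c"
    using assms by (simp add: r_neg)
qed

text \<open>The brace axiom in its usual subtraction-free form. It can be checked coordinatewise or
  pointwise, which is how both constructions below are shown to be braces.\<close>

lemma left_braceI:
  fixes A (structure)
  assumes "abelian_group A" "group A"
    and distrib: "\<And>a b c. \<lbrakk>a \<in> carrier A; b \<in> carrier A; c \<in> carrier A\<rbrakk>
      \<Longrightarrow> a \<otimes> (b \<oplus> c) \<oplus> a = (a \<otimes> b) \<oplus> (a \<otimes> c)"
  shows "left_brace A"
proof -
  interpret abelian_group A by fact
  interpret group A by fact
  show ?thesis
  proof
    fix a b c assume abc: "a \<in> carrier A" "b \<in> carrier A" "c \<in> carrier A"
    have cl: "brace_mult A a x \<in> carrier A" if "x \<in> carrier A" for x
      using abc that by (simp add: brace_mult_def)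
    have eq: "a \<otimes> x = brace_mult A a x \<oplus> a \<oplus> x" if "x \<in> carrier A" for x
      using brace_mult_eq_iff[of a x "brace_mult A a x"] abc cl that by simp
    have "a \<otimes> (b \<oplus> c) \<oplus> a = (a \<otimes> b) \<oplus> (a \<otimes> c)"
      using abc by (rule distrib)
    also have "\<dots> = (brace_mult A a b \<oplus> brace_mult A a c) \<oplus> a \<oplus> (b \<oplus> c) \<oplus> a"
      using abc cl by (simp add: eq[of b] eq[of c] a_ac)
    \<comment> \<open>The expansions of \<open>a \<otimes> b\<close> and
      \<open>a \<otimes> c\<close> contribute \<open>a\<close> twice; one copy cancels against the
      extra \<open>a\<close> on the left.\<close>
    finally have "a \<otimes> (b \<oplus> c) = (brace_mult A a b \<oplus> brace_mult A a c) \<oplus> a \<oplus> (b \<oplus> c)"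
      using abc cl by simp
    then show "brace_mult A a (b \<oplus> c) = brace_mult A a b \<oplus> brace_mult A a c"
      using abc cl by (subst brace_mult_eq_iff) auto
  qed
qed

context left_brace
begin

lemma brace_mult_closed [simp, intro]:
  "\<lbrakk>a \<in> carrier A; b \<in> carrier A\<rbrakk> \<Longrightarrow> brace_mult A a b \<in> carrier A"
  by (simp add: brace_mult_def)

lemma circ_eq_brace_mult:
  "\<lbrakk>a \<in> carrier A; b \<in> carrier A\<rbrakk> \<Longrightarrow> a \<otimes> b = brace_mult A a b \<oplus> a \<oplus> b"
  using brace_mult_eq_iff[of a b "brace_mult A a b"] by simp

lemma circ_add:
  assumes "a \<in> carrier A" "b \<in> carrier A" "c \<in> carrier A"
  shows "a \<otimes> (b \<oplus> c) \<oplus> a = (a \<otimes> b) \<oplus> (a \<otimes> c)"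
  using assms
  by (simp add: circ_eq_brace_mult[of a b] circ_eq_brace_mult[of a c]
      circ_eq_brace_mult[of a "b \<oplus> c"] brace_distrib a_ac)

text \<open>For \<open>a = \<one>\<close> and \<open>b = c = \<zero>\<close> the left side of
  \<open>circ_add\<close> collapses to \<open>\<one>\<close> and the right side to
  \<open>\<zero>\<close>.\<close>

lemma one_eq_zero: "\<one> = \<zero>"
  using circ_add[of \<one> \<zero> \<zero>] by simp

lemma brace_mult_zero_left [simp]:
  assumes "a \<in> carrier A"
  shows "brace_mult A \<zero> a = \<zero>"
proof -
  have "\<zero> \<otimes> a = a"
    using assms l_one one_eq_zero by simp
  then show ?thesis
    using assms by (subst brace_mult_eq_iff) auto
qed

text \<open>The recursion starts at index 1 because the value at 0 is a dummy; hence the case split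
  on \<open>n \<ge> 1\<close> in inductions over the series.\<close>

lemma brace_series_Suc:
  "n \<ge> 1 \<Longrightarrow> brace_series A (Suc n) = generate (add_monoid A)
     {brace_mult A x a | x a. x \<in> brace_series A n \<and> a \<in> carrier A}"
  by (cases n) auto

lemma brace_series_subset: "brace_series A n \<subseteq> carrier A"
proof (induction n)
  case (Suc n)
  show ?case
  proof (cases "n \<ge> 1")
    case True
    show ?thesis
      unfolding brace_series_Suc[OF True]
      by (rule add.generate_incl) (use Suc in auto)
  qed (auto simp: not_le)
qed simp

lemma brace_series_in_carrier: "x \<in> brace_series A n \<Longrightarrow> x \<in> carrier A"
  using brace_series_subset by blast

lemma zero_in_brace_series: "\<zero> \<in> brace_series A n"
proof (cases "n \<ge> 2")
  case True
  then obtain k where "n = Suc (Suc k)"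
    by (metis add_2_eq_Suc le_Suc_ex)
  then show ?thesis
    using generate.one[of "add_monoid A"] by simp
next
  case False
  then have "n = 0 \<or> n = Suc 0" by auto
  then show ?thesis by auto
qed

text \<open>Once a term vanishes, the next one is generated by products
  \<open>\<zero> \<cdot> a = \<zero>\<close>. This lets the indices at which two series vanish be
  raised to a common one.\<close>

lemma brace_series_zero_mono:
  assumes "brace_series A n = {\<zero>}" "n \<ge> 1" "n \<le> m"
  shows "brace_series A m = {\<zero>}"
  using assms(3)
proof (induction m rule: dec_induct)
  case (step m)
  have "subgroup {\<zero>} (add_monoid A)"
    using add.triv_subgroup by simp
  moreover have "{brace_mult A x a | x a. x \<in> brace_series A m \<and> a \<in> carrier A} \<subseteq> {\<zero>}"
    unfolding step.IH by auto
  ultimately have "generate (add_monoid A)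
      {brace_mult A x a | x a. x \<in> brace_series A m \<and> a \<in> carrier A} \<subseteq> {\<zero>}"
    by (intro add.generate_subgroup_incl)
  then have "brace_series A (Suc m) \<subseteq> {\<zero>}"
    using brace_series_Suc[of m] assms(2) step.hyps by simp
  then show ?case
    using zero_in_brace_series by blast
qed (fact assms)

end

section \<open>Homomorphisms of braces and the right series\<close>

lemma brace_hom_brace_mult:
  assumes "left_brace A" "left_brace B" "f \<in> brace_hom A B"
    and xy: "x \<in> carrier A" "y \<in> carrier A"
  shows "f (brace_mult A x y) = brace_mult B (f x) (f y)"
proof -
  interpret A: left_brace A by fact
  interpret B: left_brace B by fact
  have add: "f (u \<oplus>\<^bsub>A\<^esub> v) = f u \<oplus>\<^bsub>B\<^esub> f v" and circ: "f (u \<otimes>\<^bsub>A\<^esub> v) = f u \<otimes>\<^bsub>B\<^esub> f v"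
    and cl: "f u \<in> carrier B" if "u \<in> carrier A" "v \<in> carrier A" for u v
    using assms(3) that by (auto simp: brace_hom_def hom_def)
  \<comment> \<open>Applying \<open>f\<close> to the sum form of the circle operation gives an
    equation that determines the product in \<open>B\<close>, with no subtraction to carry through
    \<open>f\<close>.\<close>
  have "f x \<otimes>\<^bsub>B\<^esub> f y = f (brace_mult A x y \<oplus>\<^bsub>A\<^esub> x \<oplus>\<^bsub>A\<^esub> y)"
    using xy by (simp add: A.circ_eq_brace_mult flip: circ)
  then have "f x \<otimes>\<^bsub>B\<^esub> f y = f (brace_mult A x y) \<oplus>\<^bsub>B\<^esub> f x \<oplus>\<^bsub>B\<^esub> f y"
    using xy by (simp add: add)
  then have "brace_mult B (f x) (f y) = f (brace_mult A x y)"
    using xy cl by (subst B.brace_mult_eq_iff) auto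
  then show ?thesis by simp
qed

text \<open>Only additivity of \<open>f\<close> is assumed, so this also serves the projection
  \<open>fst\<close> of a semidirect product, which need not preserve the circle operation.\<close>

lemma add_hom_generate_subset:
  assumes "left_brace A" "left_brace B" "f \<in> hom (add_monoid A) (add_monoid B)"
    and "X \<subseteq> carrier A" "f ` X \<subseteq> Y"
  shows "f ` generate (add_monoid A) X \<subseteq> generate (add_monoid B) Y"
proof -
  interpret A: left_brace A by fact
  interpret B: left_brace B by fact
  interpret group_hom "add_monoid A" "add_monoid B" f
    using assms(3) by unfold_locales
  show ?thesis
    using generate_img[of X] B.add.mono_generate[OF assms(5)] assms(4) by simp
qed

lemma brace_hom_brace_series:
  assumes A: "left_brace A" and B: "left_brace B" and f: "f \<in> brace_hom A B"
  shows "f ` brace_series A n \<subseteq> brace_series B n"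
proof (induction n)
  case 0
  then show ?case
    using f by (auto simp: brace_hom_def hom_def)
next
  case (Suc n)
  interpret A: left_brace A by fact
  interpret B: left_brace B by fact
  show ?case
  proof (cases "n \<ge> 1")
    case True
    show ?thesis
      unfolding A.brace_series_Suc[OF True] B.brace_series_Suc[OF True]
    proof (rule add_hom_generate_subset[OF A B])
      show "f \<in> hom (add_monoid A) (add_monoid B)"
        using f by (simp add: brace_hom_def)
      show "{brace_mult A x a | x a. x \<in> brace_series A n \<and> a \<in> carrier A} \<subseteq> carrier A"
        using A.brace_series_in_carrier by auto
      have "f a \<in> carrier B" if "a \<in> carrier A" for a
        using f that by (auto simp: brace_hom_def hom_def)
      then show "f ` {brace_mult A x a | x a. x \<in> brace_series A n \<and> a \<in> carrier A}
          \<subseteq> {brace_mult B x a | x a. x \<in> brace_series B n \<and> a \<in> carrier B}"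
        using Suc A.brace_series_in_carrier
        by (fastforce simp: brace_hom_brace_mult[OF A B f])
    qed
  next
    case False
    then show ?thesis
      using f by (auto simp: brace_hom_def hom_def not_le)
  qed
qed

subsection \<open>Semidirect products\<close>

locale brace_action = N: left_brace N + H: left_brace H
  for N :: "('a, 'm) ring_scheme" and H :: "('b, 'n) ring_scheme" +
  fixes \<sigma> :: "'b \<Rightarrow> 'a \<Rightarrow> 'a"
  assumes action: "\<sigma> \<in> hom H (brace_Aut N)"
begin

abbreviation S where "S \<equiv> brace_semidirect N H \<sigma>"

lemma act_hom: "h \<in> carrier H \<Longrightarrow> \<sigma> h \<in> brace_hom N N \<inter> Bij (carrier N)"
  using action by (auto simp: hom_def brace_Aut_def)

lemma act_closed [simp]: "\<lbrakk>h \<in> carrier H; g \<in> carrier N\<rbrakk> \<Longrightarrow> \<sigma> h g \<in> carrier N"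
  using act_hom by (auto simp: brace_hom_def hom_def)

lemma act_add: "\<lbrakk>h \<in> carrier H; x \<in> carrier N; y \<in> carrier N\<rbrakk>
    \<Longrightarrow> \<sigma> h (x \<oplus>\<^bsub>N\<^esub> y) = \<sigma> h x \<oplus>\<^bsub>N\<^esub> \<sigma> h y"
  using act_hom by (fastforce simp: brace_hom_def hom_def)

lemma act_circ: "\<lbrakk>h \<in> carrier H; x \<in> carrier N; y \<in> carrier N\<rbrakk>
    \<Longrightarrow> \<sigma> h (x \<otimes>\<^bsub>N\<^esub> y) = \<sigma> h x \<otimes>\<^bsub>N\<^esub> \<sigma> h y"
  using act_hom by (fastforce simp: brace_hom_def hom_def)

text \<open>The image of the identity is idempotent, and a group has no other idempotent than its
  identity.\<close>

lemma act_one: "h \<in> carrier H \<Longrightarrow> \<sigma> h \<one>\<^bsub>N\<^esub> = \<one>\<^bsub>N\<^esub>"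
  using act_circ[of h "\<one>\<^bsub>N\<^esub>" "\<one>\<^bsub>N\<^esub>"] N.r_cancel_one[of "\<sigma> h \<one>\<^bsub>N\<^esub>" "\<sigma> h \<one>\<^bsub>N\<^esub>"] by simp

lemma act_act:
  assumes "h \<in> carrier H" "k \<in> carrier H" "x \<in> carrier N"
  shows "\<sigma> h (\<sigma> k x) = \<sigma> (h \<otimes>\<^bsub>H\<^esub> k) x"
proof -
  \<comment> \<open>Multiplication in \<open>BijGroup\<close> is \<open>compose\<close> guarded by
    membership in \<open>Bij\<close>, so \<open>act_hom\<close> is supplied for both
    factors.\<close>
  have "\<sigma> (h \<otimes>\<^bsub>H\<^esub> k) = compose (carrier N) (\<sigma> h) (\<sigma> k)"
    using action assms act_hom[of h] act_hom[of k]
    by (simp add: hom_def brace_Aut_def BijGroup_def)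
  then show ?thesis
    using assms by (simp add: compose_def)
qed

text \<open>Applying \<open>\<sigma> \<one>\<close> twice equals applying it once, and injectivity
  on the carrier removes one application.\<close>

lemma act_id: "x \<in> carrier N \<Longrightarrow> \<sigma> \<one>\<^bsub>H\<^esub> x = x"
  using act_act[of "\<one>\<^bsub>H\<^esub>" "\<one>\<^bsub>H\<^esub>" x] act_hom[of "\<one>\<^bsub>H\<^esub>"]
  by (auto simp: Bij_def bij_betw_def dest: inj_onD)

lemma semidirect_simps [simp]:
  "carrier S = carrier N \<times> carrier H"
  "(g1, h1) \<otimes>\<^bsub>S\<^esub> (g2, h2) = (g1 \<otimes>\<^bsub>N\<^esub> \<sigma> h1 g2, h1 \<otimes>\<^bsub>H\<^esub> h2)"
  "(g1, h1) \<oplus>\<^bsub>S\<^esub> (g2, h2) = (g1 \<oplus>\<^bsub>N\<^esub> g2, h1 \<oplus>\<^bsub>H\<^esub> h2)"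
  "\<one>\<^bsub>S\<^esub> = (\<one>\<^bsub>N\<^esub>, \<one>\<^bsub>H\<^esub>)"
  "\<zero>\<^bsub>S\<^esub> = (\<zero>\<^bsub>N\<^esub>, \<zero>\<^bsub>H\<^esub>)"
  by (simp_all add: brace_semidirect_def)

lemma semidirect_left_brace: "left_brace S"
proof (rule left_braceI)
  show "abelian_group S"
  proof (rule abelian_groupI)
    fix x assume "x \<in> carrier S"
    then show "\<exists>y\<in>carrier S. y \<oplus>\<^bsub>S\<^esub> x = \<zero>\<^bsub>S\<^esub>"
      by (intro bexI[of _ "(\<ominus>\<^bsub>N\<^esub> fst x, \<ominus>\<^bsub>H\<^esub> snd x)"]) (auto simp: N.l_neg H.l_neg)
  qed (auto simp: N.a_ac H.a_ac)
  show "group S"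
  proof (rule groupI)
    fix x assume "x \<in> carrier S"
    then obtain g h where x: "x = (g, h)" "g \<in> carrier N" "h \<in> carrier H"
      by auto
    \<comment> \<open>In the first coordinate \<open>\<sigma> (inv h)\<close> is pulled out of the
      circle product of \<open>inv g\<close> and \<open>g\<close>, leaving the image of the
      identity.\<close>
    then have "(\<sigma> (inv\<^bsub>H\<^esub> h) (inv\<^bsub>N\<^esub> g), inv\<^bsub>H\<^esub> h) \<otimes>\<^bsub>S\<^esub> x = \<one>\<^bsub>S\<^esub>"
      by (simp add: act_one flip: act_circ)
    then show "\<exists>y\<in>carrier S. y \<otimes>\<^bsub>S\<^esub> x = \<one>\<^bsub>S\<^esub>"
      using x by (intro bexI[of _ "(\<sigma> (inv\<^bsub>H\<^esub> h) (inv\<^bsub>N\<^esub> g), inv\<^bsub>H\<^esub> h)"]) auto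
  qed (auto simp: act_id act_act act_circ N.m_assoc H.m_assoc)
qed (auto simp: act_add N.circ_add H.circ_add)

text \<open>Here the action drops out: \<open>\<zero>\<close> is also the identity of the adjoint
  group of \<open>H\<close>, so it acts trivially and its product with \<open>h\<close> is
  \<open>\<zero>\<close>.\<close>

lemma semidirect_brace_mult_zero:
  assumes "g1 \<in> carrier N" "g2 \<in> carrier N" "h \<in> carrier H"
  shows "brace_mult S (g1, \<zero>\<^bsub>H\<^esub>) (g2, h) = (brace_mult N g1 g2, \<zero>\<^bsub>H\<^esub>)"
proof -
  interpret S: left_brace S by (rule semidirect_left_brace)
  have "\<sigma> \<zero>\<^bsub>H\<^esub> g2 = g2" "\<zero>\<^bsub>H\<^esub> \<otimes>\<^bsub>H\<^esub> h = h"
    using assms act_id H.l_one H.one_eq_zero by simp_all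
  then show ?thesis
    using assms N.circ_eq_brace_mult by (subst S.brace_mult_eq_iff) auto
qed

text \<open>From index \<open>m\<close> on, left factors have second coordinate zero, and on such
  elements \<open>fst\<close> respects the brace product. Index \<open>m\<close> of \<open>S\<close>
  is matched with index 1 of \<open>N\<close>, whose term is the whole carrier, so the base case is
  trivial.\<close>

lemma fst_brace_series_subset:
  assumes m: "m \<ge> 1" "brace_series H m = {\<zero>\<^bsub>H\<^esub>}"
  shows "fst ` brace_series S (m + k) \<subseteq> brace_series N (Suc k)"
proof (induction k)
  case 0
  interpret S: left_brace S by (rule semidirect_left_brace)
  show ?case
    using S.brace_series_in_carrier by fastforce
next
  case (Suc k)
  interpret S: left_brace S by (rule semidirect_left_brace)
  let ?X = "{brace_mult S x a | x a. x \<in> brace_series S (m + k) \<and> a \<in> carrier S}"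
  \<comment> \<open>Unlike \<open>fst\<close>, the projection \<open>snd\<close> is a brace
    homomorphism for every action.\<close>
  have "snd ` brace_series S (m + k) \<subseteq> brace_series H (m + k)"
    using semidirect_left_brace H.left_brace_axioms
    by (rule brace_hom_brace_series) (auto simp: brace_hom_def hom_def)
  also have "\<dots> = {\<zero>\<^bsub>H\<^esub>}"
    using H.brace_series_zero_mono[OF m(2,1)] by simp
  finally have snd: "snd x = \<zero>\<^bsub>H\<^esub>" if "x \<in> brace_series S (m + k)" for x
    using that by auto
  have "fst ` generate (add_monoid S) ?X \<subseteq> generate (add_monoid N)
      {brace_mult N x a | x a. x \<in> brace_series N (Suc k) \<and> a \<in> carrier N}"
  proof (rule add_hom_generate_subset[OF semidirect_left_brace N.left_brace_axioms])
    show "fst \<in> hom (add_monoid S) (add_monoid N)"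
      by (auto simp: hom_def)
    show "?X \<subseteq> carrier S"
      using S.brace_series_in_carrier S.brace_mult_closed by blast
    show "fst ` ?X \<subseteq> {brace_mult N x a | x a. x \<in> brace_series N (Suc k) \<and> a \<in> carrier N}"
    proof (rule image_subsetI)
      fix z assume "z \<in> ?X"
      then obtain x a where z: "z = brace_mult S x a"
        and x: "x \<in> brace_series S (m + k)" and a: "a \<in> carrier S"
        by blast
      have fst_x: "fst x \<in> brace_series N (Suc k)"
        using Suc x by auto
      have "z = brace_mult S (fst x, \<zero>\<^bsub>H\<^esub>) (fst a, snd a)"
        by (metis z snd[OF x] prod.collapse)
      also have "\<dots> = (brace_mult N (fst x) (fst a), \<zero>\<^bsub>H\<^esub>)"
        using fst_x a by (intro semidirect_brace_mult_zero) (auto intro: N.brace_series_in_carrier)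
      finally have "fst z = brace_mult N (fst x) (fst a)"
        by simp
      moreover have "fst a \<in> carrier N"
        using a by auto
      ultimately show "fst z \<in> {brace_mult N x a | x a. x \<in> brace_series N (Suc k) \<and> a \<in> carrier N}"
        using fst_x by blast
    qed
  qed
  then show ?case
    using m by (simp add: S.brace_series_Suc)
qed

lemma semidirect_finite_multipermutation_level:
  assumes "finite_multipermutation_level N" "finite_multipermutation_level H"
  shows "finite_multipermutation_level S"
proof -
  interpret S: left_brace S by (rule semidirect_left_brace)
  obtain n m where n: "n \<ge> 1" "brace_series N n = {\<zero>\<^bsub>N\<^esub>}"
    and m: "m \<ge> 1" "brace_series H m = {\<zero>\<^bsub>H\<^esub>}"
    using assms by (auto simp: finite_multipermutation_level_def)
  have "snd ` brace_series S (m + n) \<subseteq> brace_series H (m + n)"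
    using semidirect_left_brace H.left_brace_axioms
    by (rule brace_hom_brace_series) (auto simp: brace_hom_def hom_def)
  \<comment> \<open>At index \<open>m + n\<close> the first coordinate lies in term
    \<open>Suc n\<close> of \<open>N\<close>, one past the vanishing one; this shift avoids
    subtraction in the index.\<close>
  moreover have "brace_series H (m + n) = {\<zero>\<^bsub>H\<^esub>}" "brace_series N (Suc n) = {\<zero>\<^bsub>N\<^esub>}"
    using H.brace_series_zero_mono[OF m(2,1)] N.brace_series_zero_mono[OF n(2,1)] by simp_all
  ultimately have "brace_series S (m + n) \<subseteq> {\<zero>\<^bsub>S\<^esub>}"
    using fst_brace_series_subset[OF m, of n] by force
  then have "brace_series S (m + n) = {\<zero>\<^bsub>S\<^esub>}"
    using S.zero_in_brace_series by blast
  then show ?thesis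
    using m(1) by (auto simp: finite_multipermutation_level_def intro!: exI[of _ "m + n"])
qed

end

subsection \<open>Wreath products\<close>

locale brace_pair = G: left_brace G + H: left_brace H
  for G :: "('a, 'm) ring_scheme" and H :: "('b, 'n) ring_scheme"
begin

section \<open>The brace of finitely supported functions\<close>

abbreviation W where "W \<equiv> fin_supp_brace G H"

lemma fin_supp_simps:
  "f \<in> carrier W \<longleftrightarrow> f \<in> carrier H \<rightarrow>\<^sub>E carrier G \<and> finite {h \<in> carrier H. f h \<noteq> \<zero>\<^bsub>G\<^esub>}"
  "f \<otimes>\<^bsub>W\<^esub> g = (\<lambda>h\<in>carrier H. f h \<otimes>\<^bsub>G\<^esub> g h)"
  "f \<oplus>\<^bsub>W\<^esub> g = (\<lambda>h\<in>carrier H. f h \<oplus>\<^bsub>G\<^esub> g h)"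
  "\<one>\<^bsub>W\<^esub> = (\<lambda>h\<in>carrier H. \<one>\<^bsub>G\<^esub>)"
  "\<zero>\<^bsub>W\<^esub> = (\<lambda>h\<in>carrier H. \<zero>\<^bsub>G\<^esub>)"
  by (simp_all add: fin_supp_brace_def)

lemma fin_supp_app [simp]: "\<lbrakk>f \<in> carrier W; h \<in> carrier H\<rbrakk> \<Longrightarrow> f h \<in> carrier G"
  by (auto simp: fin_supp_simps)

lemma fin_supp_eqI:
  "\<lbrakk>f \<in> carrier W; g \<in> carrier W; \<And>h. h \<in> carrier H \<Longrightarrow> f h = g h\<rbrakk> \<Longrightarrow> f = g"
  unfolding fin_supp_simps by (blast intro: PiE_ext)

lemma fin_supp_zero: "(\<lambda>h\<in>carrier H. \<zero>\<^bsub>G\<^esub>) \<in> carrier W"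
proof -
  have "{h \<in> carrier H. (\<lambda>h\<in>carrier H. \<zero>\<^bsub>G\<^esub>) h \<noteq> \<zero>\<^bsub>G\<^esub>} = {}" by auto
  then show ?thesis by (simp add: fin_supp_simps)
qed

lemma fin_supp_map:
  assumes "f \<in> carrier W" "p \<in> carrier G \<rightarrow> carrier G" "p \<zero>\<^bsub>G\<^esub> = \<zero>\<^bsub>G\<^esub>"
  shows "(\<lambda>h\<in>carrier H. p (f h)) \<in> carrier W"
proof -
  have "{h \<in> carrier H. (\<lambda>h\<in>carrier H. p (f h)) h \<noteq> \<zero>\<^bsub>G\<^esub>} \<subseteq> {h \<in> carrier H. f h \<noteq> \<zero>\<^bsub>G\<^esub>}"
    using assms(3) by auto
  moreover have "finite {h \<in> carrier H. f h \<noteq> \<zero>\<^bsub>G\<^esub>}"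
    using assms(1) by (simp add: fin_supp_simps)
  ultimately have "finite {h \<in> carrier H. (\<lambda>h\<in>carrier H. p (f h)) h \<noteq> \<zero>\<^bsub>G\<^esub>}"
    by (rule finite_subset)
  then show ?thesis
    using assms by (auto simp: fin_supp_simps)
qed

text \<open>As \<open>p\<close> sends a pair of zeros to zero, the new support lies in the union of
  the two old ones. Taking \<open>p\<close> to be \<open>\<oplus>\<close> or
  \<open>\<otimes>\<close> gives closure of \<open>W\<close>.\<close>

lemma fin_supp_map2:
  assumes fg: "f \<in> carrier W" "g \<in> carrier W"
    and p: "\<And>x y. \<lbrakk>x \<in> carrier G; y \<in> carrier G\<rbrakk> \<Longrightarrow> p x y \<in> carrier G"
      "p \<zero>\<^bsub>G\<^esub> \<zero>\<^bsub>G\<^esub> = \<zero>\<^bsub>G\<^esub>"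
  shows "(\<lambda>h\<in>carrier H. p (f h) (g h)) \<in> carrier W"
proof -
  have "{h \<in> carrier H. (\<lambda>h\<in>carrier H. p (f h) (g h)) h \<noteq> \<zero>\<^bsub>G\<^esub>}
      \<subseteq> {h \<in> carrier H. f h \<noteq> \<zero>\<^bsub>G\<^esub>} \<union> {h \<in> carrier H. g h \<noteq> \<zero>\<^bsub>G\<^esub>}"
    using p(2) by auto
  moreover have "finite ({h \<in> carrier H. f h \<noteq> \<zero>\<^bsub>G\<^esub>} \<union> {h \<in> carrier H. g h \<noteq> \<zero>\<^bsub>G\<^esub>})"
    using fg by (simp add: fin_supp_simps)
  ultimately have "finite {h \<in> carrier H. (\<lambda>h\<in>carrier H. p (f h) (g h)) h \<noteq> \<zero>\<^bsub>G\<^esub>}"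
    by (rule finite_subset)
  then show ?thesis
    using p(1) fg by (auto simp: fin_supp_simps)
qed

lemma fin_supp_add_closed [simp]:
  "\<lbrakk>f \<in> carrier W; g \<in> carrier W\<rbrakk> \<Longrightarrow> f \<oplus>\<^bsub>W\<^esub> g \<in> carrier W"
  unfolding fin_supp_simps(3) by (rule fin_supp_map2) auto

lemma fin_supp_circ_closed [simp]:
  "\<lbrakk>f \<in> carrier W; g \<in> carrier W\<rbrakk> \<Longrightarrow> f \<otimes>\<^bsub>W\<^esub> g \<in> carrier W"
  \<comment> \<open>The support condition speaks of \<open>\<zero>\<close>, while the group laws
    speak of \<open>\<one>\<close>; rewriting \<open>\<zero>\<close> to \<open>\<one>\<close> turns
    it into \<open>\<one> \<otimes> \<one> = \<one>\<close>.\<close>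
  unfolding fin_supp_simps(2) by (rule fin_supp_map2) (auto simp flip: G.one_eq_zero)

lemma fin_supp_one_zero_closed [simp]: "\<zero>\<^bsub>W\<^esub> \<in> carrier W" "\<one>\<^bsub>W\<^esub> \<in> carrier W"
  using fin_supp_zero by (simp_all add: fin_supp_simps(4,5) G.one_eq_zero)

lemma fin_supp_app_simps [simp]:
  assumes "h \<in> carrier H"
  shows "(f \<otimes>\<^bsub>W\<^esub> g) h = f h \<otimes>\<^bsub>G\<^esub> g h" "(f \<oplus>\<^bsub>W\<^esub> g) h = f h \<oplus>\<^bsub>G\<^esub> g h"
    "\<one>\<^bsub>W\<^esub> h = \<one>\<^bsub>G\<^esub>" "\<zero>\<^bsub>W\<^esub> h = \<zero>\<^bsub>G\<^esub>"
  using assms by (simp_all add: fin_supp_simps)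

lemma fin_supp_left_brace: "left_brace W"
proof (rule left_braceI)
  show "abelian_group W"
  proof (rule abelian_groupI)
    fix f assume f: "f \<in> carrier W"
    have neg: "(\<lambda>h\<in>carrier H. \<ominus>\<^bsub>G\<^esub> f h) \<in> carrier W"
      using f by (rule fin_supp_map) auto
    moreover have "(\<lambda>h\<in>carrier H. \<ominus>\<^bsub>G\<^esub> f h) \<oplus>\<^bsub>W\<^esub> f = \<zero>\<^bsub>W\<^esub>"
      by (rule fin_supp_eqI) (use f neg in \<open>auto simp: G.l_neg\<close>)
    ultimately show "\<exists>g\<in>carrier W. g \<oplus>\<^bsub>W\<^esub> f = \<zero>\<^bsub>W\<^esub>" by blast
  qed (auto intro!: fin_supp_eqI simp: G.a_ac)
  show "group W"
  proof (rule groupI)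
    fix f assume f: "f \<in> carrier W"
    have inv: "(\<lambda>h\<in>carrier H. inv\<^bsub>G\<^esub> f h) \<in> carrier W"
      using f by (rule fin_supp_map) (auto simp flip: G.one_eq_zero)
    moreover have "(\<lambda>h\<in>carrier H. inv\<^bsub>G\<^esub> f h) \<otimes>\<^bsub>W\<^esub> f = \<one>\<^bsub>W\<^esub>"
      by (rule fin_supp_eqI) (use f inv in auto)
    ultimately show "\<exists>g\<in>carrier W. g \<otimes>\<^bsub>W\<^esub> f = \<one>\<^bsub>W\<^esub>" by blast
  qed (auto intro!: fin_supp_eqI simp: G.m_assoc)
qed (auto intro!: fin_supp_eqI simp: G.circ_add)

text \<open>Evaluation at each point maps term \<open>n\<close> of \<open>W\<close> into term
  \<open>n\<close> of \<open>G\<close>, so one \<open>n\<close> serves all points at once.\<close>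

lemma fin_supp_finite_multipermutation_level:
  assumes "finite_multipermutation_level G"
  shows "finite_multipermutation_level W"
proof -
  interpret W: left_brace W by (rule fin_supp_left_brace)
  obtain n where n: "n \<ge> 1" "brace_series G n = {\<zero>\<^bsub>G\<^esub>}"
    using assms by (auto simp: finite_multipermutation_level_def)
  have "f = \<zero>\<^bsub>W\<^esub>" if f: "f \<in> brace_series W n" for f
  proof (rule fin_supp_eqI)
    fix h assume h: "h \<in> carrier H"
    have "(\<lambda>f. f h) ` brace_series W n \<subseteq> brace_series G n"
      using fin_supp_left_brace G.left_brace_axioms
      by (rule brace_hom_brace_series) (use h in \<open>auto simp: brace_hom_def hom_def\<close>)
    then show "f h = \<zero>\<^bsub>W\<^esub> h"
      using f h n by auto
  qed (use f W.brace_series_in_carrier in auto)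
  then have "brace_series W n = {\<zero>\<^bsub>W\<^esub>}"
    using W.zero_in_brace_series by blast
  then show ?thesis
    using n(1) by (auto simp: finite_multipermutation_level_def)
qed

section \<open>The shift action on the base\<close>

lemma shift_app [simp]: "\<lbrakk>f \<in> carrier W; x \<in> carrier H\<rbrakk>
    \<Longrightarrow> shift_action G H h f x = f (inv\<^bsub>H\<^esub> h \<otimes>\<^bsub>H\<^esub> x)"
  by (simp add: shift_action_def)

text \<open>The shifted support lies in the left translate by \<open>h\<close> of the support of
  \<open>f\<close>, a finite image; a point \<open>x\<close> comes from
  \<open>inv h \<otimes> x\<close>.\<close>

lemma shift_closed [simp]:
  assumes "h \<in> carrier H" "f \<in> carrier W"
  shows "shift_action G H h f \<in> carrier W"
proof -
  have "{x \<in> carrier H. shift_action G H h f x \<noteq> \<zero>\<^bsub>G\<^esub>}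
      \<subseteq> (\<lambda>y. h \<otimes>\<^bsub>H\<^esub> y) ` {y \<in> carrier H. f y \<noteq> \<zero>\<^bsub>G\<^esub>}"
  proof safe
    fix x assume x: "x \<in> carrier H" "shift_action G H h f x \<noteq> \<zero>\<^bsub>G\<^esub>"
    then have "x = h \<otimes>\<^bsub>H\<^esub> (inv\<^bsub>H\<^esub> h \<otimes>\<^bsub>H\<^esub> x)"
      using assms by (simp flip: H.m_assoc)
    then show "x \<in> (\<lambda>y. h \<otimes>\<^bsub>H\<^esub> y) ` {y \<in> carrier H. f y \<noteq> \<zero>\<^bsub>G\<^esub>}"
      using x assms by (intro image_eqI) auto
  qed
  then have "finite {x \<in> carrier H. shift_action G H h f x \<noteq> \<zero>\<^bsub>G\<^esub>}"
    using assms(2) by (auto simp: fin_supp_simps intro: finite_subset)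
  moreover have "shift_action G H h f \<in> carrier H \<rightarrow>\<^sub>E carrier G"
    using assms by (auto simp: shift_action_def)
  ultimately show ?thesis by (simp add: fin_supp_simps(1))
qed

text \<open>The inverse in the shift reverses the order of factors, and inverting
  \<open>h \<otimes> k\<close> reverses it again, so this is a left action.\<close>

lemma shift_shift:
  assumes "h \<in> carrier H" "k \<in> carrier H" "f \<in> carrier W"
  shows "shift_action G H h (shift_action G H k f) = shift_action G H (h \<otimes>\<^bsub>H\<^esub> k) f"
  by (rule fin_supp_eqI) (use assms in \<open>auto simp: H.inv_mult_group H.m_assoc\<close>)

lemma shift_one: "f \<in> carrier W \<Longrightarrow> shift_action G H \<one>\<^bsub>H\<^esub> f = f"
  by (rule fin_supp_eqI) auto

lemma shift_Bij:
  assumes h: "h \<in> carrier H"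
  shows "shift_action G H h \<in> Bij (carrier W)"
proof -
  have "bij_betw (shift_action G H h) (carrier W) (carrier W)"
    \<comment> \<open>Shifting by \<open>inv h\<close> is the two-sided inverse, by
      \<open>shift_shift\<close> and \<open>shift_one\<close>.\<close>
    by (rule bij_betw_byWitness[where f' = "shift_action G H (inv\<^bsub>H\<^esub> h)"])
      (use h in \<open>auto simp: shift_shift shift_one\<close>)
  then show ?thesis
    by (simp add: Bij_def shift_action_def)
qed

lemma shift_brace_hom:
  assumes h: "h \<in> carrier H"
  shows "shift_action G H h \<in> brace_hom W W"
  unfolding brace_hom_def hom_def using h by (auto intro!: fin_supp_eqI)

lemma shift_hom: "shift_action G H \<in> hom H (brace_Aut W)"
proof (rule homI)
  fix h k assume hk: "h \<in> carrier H" "k \<in> carrier H"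
  have "shift_action G H (h \<otimes>\<^bsub>H\<^esub> k)
      = compose (carrier W) (shift_action G H h) (shift_action G H k)"
    \<comment> \<open>Both sides are extensional, so they agree off the carrier of \<open>W\<close>
      by default and only \<open>shift_shift\<close> on the carrier remains.\<close>
    using hk by (intro extensionalityI[of _ "carrier W"])
      (auto simp: shift_shift compose_def, simp add: shift_action_def)
  then show "shift_action G H (h \<otimes>\<^bsub>H\<^esub> k)
      = shift_action G H h \<otimes>\<^bsub>brace_Aut W\<^esub> shift_action G H k"
    using hk shift_Bij by (simp add: brace_Aut_def BijGroup_def)
qed (auto simp: brace_Aut_def shift_Bij shift_brace_hom)

end

theorem proposition1:
  fixes A :: "('a, 'm) ring_scheme" and B :: "('b, 'n) ring_scheme"
  assumes "left_brace A" and "finite_multipermutation_level A"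
    and "left_brace B" and "finite_multipermutation_level B"
  shows "(\<forall>\<sigma> \<in> hom B (brace_Aut A).
            left_brace (brace_semidirect A B \<sigma>) \<and>
            finite_multipermutation_level (brace_semidirect A B \<sigma>)) \<and>
         left_brace (brace_wreath A B) \<and>
         finite_multipermutation_level (brace_wreath A B)"
proof -
  interpret pair: brace_pair A B
    using assms by (simp add: brace_pair_def)
  have semidirect: "brace_action A B \<sigma>" if "\<sigma> \<in> hom B (brace_Aut A)" for \<sigma>
    using assms that by (simp add: brace_action_def brace_action_axioms_def)
  \<comment> \<open>The wreath product is by definition the semidirect product for this action, so
    the results on semidirect products apply with base \<open>W\<close>.\<close>
  have wreath: "brace_action pair.W B (shift_action A B)"
    using assms pair.fin_supp_left_brace pair.shift_hom
    by (simp add: brace_action_def brace_action_axioms_def)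
  show ?thesis
    unfolding brace_wreath_def
    using brace_action.semidirect_left_brace[OF semidirect]
      brace_action.semidirect_finite_multipermutation_level[OF semidirect assms(2,4)]
      brace_action.semidirect_left_brace[OF wreath]
      brace_action.semidirect_finite_multipermutation_level[OF wreath
        pair.fin_supp_finite_multipermutation_level[OF assms(2)] assms(4)]
    by simp
qed

end
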